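(* Let (Flow-Cov) and its alternative version be the mixed-integer programs defined in the context, and let $P$ be any set of pairs $(i,j)$ with $i,j\in V$, $i<j$ and $d(i,j)\le R$. Then for the pairs in $P$ it is not necessary to include the $f$-variables and the $\alpha$-variables (respectively $\gamma$-variables): if, for every $(i,j)\in P$, all variables $f_a^{ij}$ and $\alpha_a^{ij}$ (respectively $\gamma_a^{ij}$), $a\in A_{ij}$, are deleted together with all constraints (indexed by that pair) in which they occur, i.e. all constraints listed under "pair constraints" for $(i,j)$ in the original (respectively alternative) version, then the resulting program has the same optimal value as the original (respectively alternative) (Flow-Cov).
   Context: Setting. $N=(V,E,\ell)$ is an undirected network with $V=\{1,\dots,n\}$; each edge $e=[k,q]=[q,k]\in E$ is an unordered pair of distinct nodes with length $\ell_e>0$, maximal length reduction $u_e\in[0,\ell_e)$ and unit reduction cost $c_e\ge 0$. Given are a coverage radius $R>0$, a budget $B\ge 0$, a number of facilities $p\in\mathbb N$, and demands $w_i\ge 0$, $i\in V$. Standing assumptions: $\ell_e-u_e\le R$ and $c_eu_e\le B$ for all $e\in E$. $d(i,j)$ is the length of a shortest path between $i$ and $j$ with respect to the (non-reduced) lengths $\ell$. Let $A$ be the arc set containing both arcs $(i,j)$ and $(j,i)$ for each $[i,j]\in E$; for $a\in A$, $e_a\in E$ is its underlying edge; $\Gamma_i^+$ (resp. $\Gamma_i^-$) is the set of arcs of $A$ leaving (resp. entering) node $i$. For $i<j$ put $A_{ij}=A\setminus(\Gamma_i^-\cup\Gamma_j^+)$. (Flow-Cov), original version, has variables $x_j$ ($j\in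 V$), $y_{ij}$ ($i\ne j$), $\delta_e$ ($e\in E$), $f_a^{ij}$ and $\alpha_a^{ij}$ ($i<j$, $a\in A_{ij}$), and reads: maximize $\sum_{i\in V}w_i\big(\sum_{j\in V\setminus\{i\}}y_{ij}+x_i\big)$ subject to Base constraints: $\sum_{j\in V}x_j=p$; $\sum_{j\in V\setminus\{i\}}y_{ij}+x_i\le 1$ for $i\in V$; $y_{ij}\le x_j$ for $i\neq j$; $\sum_{e\in E}c_e\delta_e\le B$; $0\le\delta_e\le u_e$ for $e\in E$; $x_j\in\{0,1\}$ for $j\in V$; $y_{ij}\in\{0,1\}$ for $i\ne j$. Pair constraints, for each pair $i<j$: - $\sum_{a\in A_{ij}}\alpha_a^{ij}\le R$; - $\alpha_a^{ij}\ge f_a^{ij}\ell_{e_a}-\delta_{e_a}$ for $a\in A_{ij}$; - $0\le\alpha_a^{ij}\le\ell_{e_a}-\delta_{e_a}$ for $a\in A_{ij}$; - $\sum_{a\in\Gamma_k^+,\,a\notin\Gamma_i^-}f_a^{ij}-\sum_{a\in\Gamma_k^-,\,a\notin\Gamma_j^+}f_a^{ij}=0$ for $k\in V\setminus\{i,j\}$; - $\sum_{a\in\Gamma_i^+}f_a^{ij}=y_{ij}+y_{ji}$ and $\sum_{a\in\Gamma_j^-}f_a^{ij}=y_{ij}+y_{ji}$ (sums over arcs in $A_{ij}$); - $f_a^{ij}\in\{0,1\}$ for $a\in A_{ij}$. The alternative version has variables $\gamma_a^{ij}$ instead of $\alpha_a^{ij}$ and is obtained by replacing the first three pair constraints by: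 $\sum_{a\in A_{ij}}(f_a^{ij}\ell_{e_a}-\gamma_a^{ij})\le R$; $\gamma_a^{ij}\le u_{e_a}f_a^{ij}$ for $a\in A_{ij}$; $0\le\gamma_a^{ij}\le\delta_{e_a}$ for $a\in A_{ij}$. *)

theory Defs
  imports "Graph_Theory.Graph_Theory" "HOL-Library.FuncSet"
begin

text \<open>Edges are two-element sets of nodes, so \<open>{k, q}\<close> stands for the unordered pair \<open>[k, q]\<close>.\<close>

record instance_data =
  num_nodes :: nat
  edges :: "nat set set"
  len :: "nat set \<Rightarrow> real"
  max_red :: "nat set \<Rightarrow> real"
  unit_cost :: "nat set \<Rightarrow> real"
  radius :: real
  budget :: real
  num_fac :: nat
  demand :: "nat \<Rightarrow> real"

definition nodes :: "instance_data \<Rightarrow> nat set" where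
  "nodes N = {1..num_nodes N}"

definition valid_instance :: "instance_data \<Rightarrow> bool" where
  "valid_instance N \<longleftrightarrow>
     edges N \<subseteq> {{k, q} | k q. k \<in> nodes N \<and> q \<in> nodes N \<and> k \<noteq> q} \<and>
     (\<forall>e\<in>edges N. 0 < len N e \<and> 0 \<le> max_red N e \<and> max_red N e < len N e \<and> 0 \<le> unit_cost N e) \<and>
     0 < radius N \<and> 0 \<le> budget N \<and>
     (\<forall>i\<in>nodes N. 0 \<le> demand N i) \<and>
     (\<forall>e\<in>edges N. len N e - max_red N e \<le> radius N \<and> unit_cost N e * max_red N e \<le> budget N)"

text \<open>The bidirected digraph with both arcs \<open>(i, j)\<close> and \<open>(j, i)\<close> for each edge \<open>{i, j}\<close>.\<close>

definition arc_graph :: "instance_data \<Rightarrow> (nat, nat \<times> nat) pre_digraph" where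
  "arc_graph N = \<lparr>verts = nodes N, arcs = {(i, j). {i, j} \<in> edges N}, tail = fst, head = snd\<rparr>"

definition edge_of :: "nat \<times> nat \<Rightarrow> nat set" where
  "edge_of a = {fst a, snd a}"

text \<open>The library constant \<open>wf_digraph.\<mu>\<close> is the infimum of the walk lengths (\<open>\<infinity>\<close> if there is
  no walk); it is only specified on well-formed digraphs, which the next lemma covers.\<close>

lemma wf_arc_graph: "valid_instance N \<Longrightarrow> wf_digraph (arc_graph N)"
  by unfold_locales (fastforce simp: valid_instance_def arc_graph_def doubleton_eq_iff)+

definition distance :: "instance_data \<Rightarrow> nat \<Rightarrow> nat \<Rightarrow> ereal" where
  "distance N i j = wf_digraph.\<mu> (arc_graph N) (\<lambda>a. len N (edge_of a)) i j"

definition arcs_for :: "instance_data \<Rightarrow> nat \<Rightarrow> nat \<Rightarrow> (nat \<times> nat) set" where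
  "arcs_for N i j = arcs (arc_graph N) - (in_arcs (arc_graph N) i \<union> out_arcs (arc_graph N) j)"

definition node_pairs :: "instance_data \<Rightarrow> (nat \<times> nat) set" where
  "node_pairs N = {(i, j). i \<in> nodes N \<and> j \<in> nodes N \<and> i < j}"

definition ordered_pairs :: "instance_data \<Rightarrow> (nat \<times> nat) set" where
  "ordered_pairs N = {(i, j). i \<in> nodes N \<and> j \<in> nodes N \<and> i \<noteq> j}"

definition objective :: "instance_data \<Rightarrow> (nat \<Rightarrow> real) \<Rightarrow> (nat \<times> nat \<Rightarrow> real) \<Rightarrow> real" where
  "objective N x y = (\<Sum>i\<in>nodes N. demand N i * ((\<Sum>j\<in>nodes N - {i}. y (i, j)) + x i))"

definition base_constraints ::
  "instance_data \<Rightarrow> (nat \<Rightarrow> real) \<Rightarrow> (nat \<times> nat \<Rightarrow> real) \<Rightarrow> (nat set \<Rightarrow> real) \<Rightarrow> bool" where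
  "base_constraints N x y \<delta> \<longleftrightarrow>
     (\<Sum>j\<in>nodes N. x j) = real (num_fac N) \<and>
     (\<forall>i\<in>nodes N. (\<Sum>j\<in>nodes N - {i}. y (i, j)) + x i \<le> 1) \<and>
     (\<forall>(i, j)\<in>ordered_pairs N. y (i, j) \<le> x j) \<and>
     (\<Sum>e\<in>edges N. unit_cost N e * \<delta> e) \<le> budget N \<and>
     (\<forall>e\<in>edges N. 0 \<le> \<delta> e \<and> \<delta> e \<le> max_red N e) \<and>
     (\<forall>j\<in>nodes N. x j \<in> {0, 1}) \<and>
     (\<forall>(i, j)\<in>ordered_pairs N. y (i, j) \<in> {0, 1})"

text \<open>In the next three definitions \<open>f\<close>, \<open>\<alpha>\<close> and \<open>\<gamma>\<close> are the variables of a single pair \<open>(i, j)\<close>,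
  as functions of the arc.\<close>

definition flow_constraints ::
  "instance_data \<Rightarrow> (nat \<times> nat \<Rightarrow> real) \<Rightarrow> nat \<Rightarrow> nat \<Rightarrow> (nat \<times> nat \<Rightarrow> real) \<Rightarrow> bool" where
  "flow_constraints N y i j f \<longleftrightarrow>
     (let G = arc_graph N in
       (\<forall>k\<in>nodes N - {i, j}.
          (\<Sum>a\<in>out_arcs G k - in_arcs G i. f a) - (\<Sum>a\<in>in_arcs G k - out_arcs G j. f a) = 0) \<and>
       (\<Sum>a\<in>out_arcs G i \<inter> arcs_for N i j. f a) = y (i, j) + y (j, i) \<and>
       (\<Sum>a\<in>in_arcs G j \<inter> arcs_for N i j. f a) = y (i, j) + y (j, i) \<and>
       (\<forall>a\<in>arcs_for N i j. f a \<in> {0, 1}))"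

definition pair_constraints_orig ::
  "instance_data \<Rightarrow> (nat \<times> nat \<Rightarrow> real) \<Rightarrow> (nat set \<Rightarrow> real) \<Rightarrow> nat \<Rightarrow> nat \<Rightarrow>
   (nat \<times> nat \<Rightarrow> real) \<Rightarrow> (nat \<times> nat \<Rightarrow> real) \<Rightarrow> bool" where
  "pair_constraints_orig N y \<delta> i j f \<alpha> \<longleftrightarrow>
     (\<Sum>a\<in>arcs_for N i j. \<alpha> a) \<le> radius N \<and>
     (\<forall>a\<in>arcs_for N i j. \<alpha> a \<ge> f a * len N (edge_of a) - \<delta> (edge_of a)) \<and>
     (\<forall>a\<in>arcs_for N i j. 0 \<le> \<alpha> a \<and> \<alpha> a \<le> len N (edge_of a) - \<delta> (edge_of a)) \<and>
     flow_constraints N y i j f"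

definition pair_constraints_alt ::
  "instance_data \<Rightarrow> (nat \<times> nat \<Rightarrow> real) \<Rightarrow> (nat set \<Rightarrow> real) \<Rightarrow> nat \<Rightarrow> nat \<Rightarrow>
   (nat \<times> nat \<Rightarrow> real) \<Rightarrow> (nat \<times> nat \<Rightarrow> real) \<Rightarrow> bool" where
  "pair_constraints_alt N y \<delta> i j f \<gamma> \<longleftrightarrow>
     (\<Sum>a\<in>arcs_for N i j. f a * len N (edge_of a) - \<gamma> a) \<le> radius N \<and>
     (\<forall>a\<in>arcs_for N i j. \<gamma> a \<le> max_red N (edge_of a) * f a) \<and>
     (\<forall>a\<in>arcs_for N i j. 0 \<le> \<gamma> a \<and> \<gamma> a \<le> \<delta> (edge_of a)) \<and>
     flow_constraints N y i j f"

text \<open>\<open>K\<close> is the set of pairs for which the program has pair variables and pair constraints. Each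
  variable family is an extensional function on its index set, so a program has exactly the variables
  it declares: those of a pair outside \<open>K\<close> do not exist. The value of \<open>f\<close> at \<open>((i, j), a)\<close> is the
  variable for the pair \<open>(i, j)\<close> and the arc \<open>a\<close>; likewise for \<open>\<alpha>\<close> and \<open>\<gamma>\<close>.\<close>

type_synonym solution =
  "(nat \<Rightarrow> real) \<times> (nat \<times> nat \<Rightarrow> real) \<times> (nat set \<Rightarrow> real) \<times>
   ((nat \<times> nat) \<times> (nat \<times> nat) \<Rightarrow> real) \<times> ((nat \<times> nat) \<times> (nat \<times> nat) \<Rightarrow> real)"

definition pair_arc_index ::
  "instance_data \<Rightarrow> (nat \<times> nat) set \<Rightarrow> ((nat \<times> nat) \<times> (nat \<times> nat)) set" where
  "pair_arc_index N K = (SIGMA ij:K. arcs_for N (fst ij) (snd ij))"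

definition feasible_orig :: "instance_data \<Rightarrow> (nat \<times> nat) set \<Rightarrow> solution set" where
  "feasible_orig N K = {(x, y, \<delta>, f, \<alpha>).
     x \<in> extensional (nodes N) \<and> y \<in> extensional (ordered_pairs N) \<and> \<delta> \<in> extensional (edges N) \<and>
     f \<in> extensional (pair_arc_index N K) \<and> \<alpha> \<in> extensional (pair_arc_index N K) \<and>
     base_constraints N x y \<delta> \<and>
     (\<forall>(i, j)\<in>K. pair_constraints_orig N y \<delta> i j (\<lambda>a. f ((i, j), a)) (\<lambda>a. \<alpha> ((i, j), a)))}"

definition feasible_alt :: "instance_data \<Rightarrow> (nat \<times> nat) set \<Rightarrow> solution set" where
  "feasible_alt N K = {(x, y, \<delta>, f, \<gamma>).
     x \<in> extensional (nodes N) \<and> y \<in> extensional (ordered_pairs N) \<and> \<delta> \<in> extensional (edges N) \<and>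
     f \<in> extensional (pair_arc_index N K) \<and> \<gamma> \<in> extensional (pair_arc_index N K) \<and>
     base_constraints N x y \<delta> \<and>
     (\<forall>(i, j)\<in>K. pair_constraints_alt N y \<delta> i j (\<lambda>a. f ((i, j), a)) (\<lambda>a. \<gamma> ((i, j), a)))}"

text \<open>The optimal value of a maximization problem; it is \<open>-\<infinity>\<close> exactly when the problem is
  infeasible. The supremum is otherwise a maximum: the objective depends only on \<open>x\<close> and \<open>y\<close>,
  which are binary.\<close>

definition optimal_value :: "instance_data \<Rightarrow> solution set \<Rightarrow> ereal" where
  "optimal_value N S = (SUP (x, y, \<delta>, f, \<alpha>)\<in>S. ereal (objective N x y))"

abbreviation flow_cov_orig :: "instance_data \<Rightarrow> solution set" where
  "flow_cov_orig N \<equiv> feasible_orig N (node_pairs N)"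

abbreviation flow_cov_alt :: "instance_data \<Rightarrow> solution set" where
  "flow_cov_alt N \<equiv> feasible_alt N (node_pairs N)"

abbreviation reduced_orig :: "instance_data \<Rightarrow> (nat \<times> nat) set \<Rightarrow> solution set" where
  "reduced_orig N P \<equiv> feasible_orig N (node_pairs N - P)"

abbreviation reduced_alt :: "instance_data \<Rightarrow> (nat \<times> nat) set \<Rightarrow> solution set" where
  "reduced_alt N P \<equiv> feasible_alt N (node_pairs N - P)"

end

theory Submission
  imports Defs
begin

text \<open>
  In the full program the pair variables exist only to certify that, once \<open>y\<^sub>i\<^sub>j + y\<^sub>j\<^sub>i = 1\<close>, the
  nodes \<open>i\<close> and \<open>j\<close> are joined by a path whose reduced length is at most \<open>R\<close>. If \<open>d(i, j) \<le> R\<close>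
  then a shortest path with respect to the original lengths is such a certificate whatever \<open>\<delta>\<close>
  is, because reductions are nonnegative. Hence the constraints of such a pair never cut off a
  choice of \<open>(x, y, \<delta>)\<close>, and the objective depends on nothing else.

  Two points carry the proof. The pair variables of different pairs never meet in a constraint, so
  a choice of \<open>(x, y, \<delta>)\<close> extends to a solution exactly if the constraints of each single pair can
  be satisfied (\<open>feasible_projection\<close>); it therefore suffices to treat one pair of \<open>P\<close> at a time.
  For such a pair, the base constraints force \<open>s = y\<^sub>i\<^sub>j + y\<^sub>j\<^sub>i \<in> {0, 1}\<close>: if both were 1, then
  \<open>x\<^sub>i = 1\<close> and \<open>i\<close> would be covered twice. Sending \<open>s\<close> units of flow along a shortest path
  satisfies the flow constraints (\<open>path_flow\<close>), and its length is at most \<open>R\<close> before any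
  reduction; in the original version \<open>\<alpha>\<close> is the reduced length of the arcs used, and in the
  alternative version no reduction is claimed at all, \<open>\<gamma> = 0\<close>.
\<close>

section \<open>Paths and flow balance\<close>

text \<open>Every arc of a walk that leaves \<open>k\<close> was preceded by one that enters \<open>k\<close>, except at the
  start, and conversely except at the end.\<close>

lemma (in pre_digraph) cas_balance:
  assumes "cas u p v"
  shows "(\<Sum>a\<leftarrow>p. of_bool (tail G a = k)) + of_bool (v = k) =
    (\<Sum>a\<leftarrow>p. of_bool (head G a = k)) + (of_bool (u = k) :: real)"
  using assms by (induction p arbitrary: u) (auto simp: algebra_simps)

lemma (in wf_digraph) apath_distinct_arcs:
  assumes "apath u p v"
  shows "distinct p"
  using assms by (auto simp: apath_def awalk_verts_conv distinct_map split: if_splits)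

lemma (in wf_digraph) apath_not_entering_start:
  assumes "apath u p v" "a \<in> set p"
  shows "head G a \<noteq> u"
proof -
  have "cas u p v" "distinct (awalk_verts u p)"
    using assms by (auto simp: apath_def)
  moreover have "tail G (hd p) = u"
    using \<open>cas u p v\<close> assms(2) by (cases p) auto
  ultimately show ?thesis
    using assms(2) by (auto simp: awalk_verts_conv' image_iff split: if_splits)
qed

lemma (in wf_digraph) apath_not_leaving_end:
  assumes "apath u p v" "a \<in> set p"
  shows "tail G a \<noteq> v"
proof -
  have "awlast u p = v" "distinct (awalk_verts u p)"
    using assms by (auto simp: apath_def)
  then show ?thesis
    using assms(2) by (auto simp: awalk_verts_conv image_iff split: if_splits)
qed

lemma sum_indicator_distinct:
  fixes s :: real
  assumes "distinct p" "finite S" "\<And>a. a \<in> set p \<Longrightarrow> a \<in> S \<longleftrightarrow> Q a"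
  shows "(\<Sum>a\<in>S. s * of_bool (a \<in> set p)) = s * (\<Sum>a\<leftarrow>p. of_bool (Q a))"
proof -
  have "(\<Sum>a\<in>S. s * of_bool (a \<in> set p)) = s * (\<Sum>a\<in>S. of_bool (a \<in> set p))"
    by (simp only: sum_distrib_left)
  also have "(\<Sum>a\<in>S. of_bool (a \<in> set p) :: real) = (\<Sum>a\<in>S \<inter> set p. 1)"
    by (rule sum.mono_neutral_cong_right) (use assms(2) in auto)
  also have "\<dots> = (\<Sum>a\<in>set p. of_bool (Q a))"
    by (rule sum.mono_neutral_cong_left) (use assms(3) in auto)
  also have "\<dots> = (\<Sum>a\<leftarrow>p. of_bool (Q a))"
    using assms(1) by (simp add: sum_list_distinct_conv_sum_set)
  finally show ?thesis .
qed

lemma fin_arc_graph: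
  assumes "valid_instance N"
  shows "fin_digraph (arc_graph N)"
proof -
  interpret wf_digraph "arc_graph N"
    by (rule wf_arc_graph[OF assms])
  have fin: "finite (verts (arc_graph N))"
    by (simp add: arc_graph_def nodes_def)
  have "arcs (arc_graph N) \<subseteq> verts (arc_graph N) \<times> verts (arc_graph N)"
    using wellformed by (fastforce simp: arc_graph_def)
  then have "finite (arcs (arc_graph N))"
    using fin finite_subset by blast
  with fin show ?thesis
    by unfold_locales
qed

text \<open>The distance is an infimum over walks; finiteness of the graph and positivity of the lengths
  make it the length of an actual path.\<close>

lemma short_path_exists:
  assumes "valid_instance N" "distance N i j \<le> ereal r"
  obtains p where "pre_digraph.apath (arc_graph N) i p j"
    "(\<Sum>a\<in>set p. len N (edge_of a)) \<le> r"
proof -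
  interpret fin_digraph "arc_graph N"
    by (rule fin_arc_graph[OF assms(1)])
  have "i \<rightarrow>\<^sup>*\<^bsub>arc_graph N\<^esub> j"
    using assms(2) \<mu>_reach_conv[of "\<lambda>a. len N (edge_of a)" i j]
    by (auto simp: distance_def)
  moreover have "0 \<le> len N (edge_of a)" if "a \<in> arcs (arc_graph N)" for a
    using that assms(1)
    by (cases a) (auto simp: valid_instance_def arc_graph_def edge_of_def intro: less_imp_le)
  ultimately obtain p where p: "apath i p j"
      "\<mu> (\<lambda>a. len N (edge_of a)) i j = awalk_cost (\<lambda>a. len N (edge_of a)) p"
    using min_cost_awalk[of i j "\<lambda>a. len N (edge_of a)"] by blast
  have "(\<Sum>a\<in>set p. len N (edge_of a)) \<le> r"
    using p assms(2) apath_distinct_arcs[OF p(1)]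
    by (simp add: distance_def awalk_cost_def sum_list_distinct_conv_sum_set)
  with p(1) show thesis
    by (rule that)
qed

lemma apath_arcs_for:
  assumes "valid_instance N" "pre_digraph.apath (arc_graph N) i p j"
  shows "set p \<subseteq> arcs_for N i j"
proof -
  interpret wf_digraph "arc_graph N"
    by (rule wf_arc_graph[OF assms(1)])
  have "set p \<subseteq> arcs (arc_graph N)"
    using assms(2) by (auto simp: apath_def)
  then show ?thesis
    using apath_not_entering_start[OF assms(2)] apath_not_leaving_end[OF assms(2)]
    by (auto simp: arcs_for_def)
qed

text \<open>Since a path neither returns to its start nor leaves its end, the arcs left out of the
  sums in the flow constraints carry no flow anyway, and \<open>cas_balance\<close> applies.\<close>

lemma path_flow:
  assumes "valid_instance N" "pre_digraph.apath (arc_graph N) i p j" "i \<noteq> j"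
    and "y (i, j) + y (j, i) \<in> {0, 1}"
  shows "flow_constraints N y i j (\<lambda>a. (y (i, j) + y (j, i)) * of_bool (a \<in> set p))"
proof -
  interpret fin_digraph "arc_graph N"
    by (rule fin_arc_graph[OF assms(1)])
  let ?G = "arc_graph N" and ?s = "y (i, j) + y (j, i)"
  note dist = apath_distinct_arcs[OF assms(2)]
  note start = apath_not_entering_start[OF assms(2)]
  note stop = apath_not_leaving_end[OF assms(2)]
  have arcs: "set p \<subseteq> arcs ?G"
    using assms(2) by (auto simp: apath_def)
  have for_p: "set p \<subseteq> arcs_for N i j"
    by (rule apath_arcs_for[OF assms(1,2)])
  have bal: "(\<Sum>a\<leftarrow>p. of_bool (tail ?G a = k)) + of_bool (j = k) =
      (\<Sum>a\<leftarrow>p. of_bool (head ?G a = k)) + (of_bool (i = k) :: real)" for k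
    by (rule cas_balance) (use assms(2) in \<open>auto simp: apath_def\<close>)
  have conserved: "(\<Sum>a\<leftarrow>p. of_bool (tail ?G a = k)) = (\<Sum>a\<leftarrow>p. of_bool (head ?G a = k) :: real)"
    if "k \<in> nodes N - {i, j}" for k
    using bal[of k] that by auto
  have no_return: "(\<Sum>a\<leftarrow>p. of_bool (head ?G a = i)) = (0 :: real)"
    unfolding sum_list_distinct_conv_sum_set[OF dist]
    by (rule sum.neutral) (use start in auto)
  have no_leave: "(\<Sum>a\<leftarrow>p. of_bool (tail ?G a = j)) = (0 :: real)"
    unfolding sum_list_distinct_conv_sum_set[OF dist]
    by (rule sum.neutral) (use stop in auto)
  have "(\<Sum>a\<in>out_arcs ?G k - in_arcs ?G i. ?s * of_bool (a \<in> set p)) =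
      ?s * (\<Sum>a\<leftarrow>p. of_bool (tail ?G a = k))" for k
    by (rule sum_indicator_distinct[OF dist]) (use start arcs in auto)
  moreover have "(\<Sum>a\<in>in_arcs ?G k - out_arcs ?G j. ?s * of_bool (a \<in> set p)) =
      ?s * (\<Sum>a\<leftarrow>p. of_bool (head ?G a = k))" for k
    by (rule sum_indicator_distinct[OF dist]) (use stop arcs in auto)
  moreover have "(\<Sum>a\<in>out_arcs ?G i \<inter> arcs_for N i j. ?s * of_bool (a \<in> set p)) =
      ?s * (\<Sum>a\<leftarrow>p. of_bool (tail ?G a = i))"
    by (rule sum_indicator_distinct[OF dist]) (use for_p arcs in auto)
  moreover have "(\<Sum>a\<in>in_arcs ?G j \<inter> arcs_for N i j. ?s * of_bool (a \<in> set p)) =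
      ?s * (\<Sum>a\<leftarrow>p. of_bool (head ?G a = j))"
    by (rule sum_indicator_distinct[OF dist]) (use for_p arcs in auto)
  ultimately show ?thesis
    using bal[of i] bal[of j] conserved no_return no_leave assms(3,4)
    by (auto simp: flow_constraints_def Let_def)
qed

section \<open>Pairs within the coverage radius impose no restriction\<close>

text \<open>If both summands were 1, then \<open>y\<^sub>j\<^sub>i \<le> x\<^sub>i\<close> would open a facility at \<open>i\<close>, which then covers
  itself and is also assigned to \<open>j\<close>.\<close>

lemma pair_demand_binary:
  assumes "base_constraints N x y \<delta>" "i \<in> nodes N" "j \<in> nodes N" "i \<noteq> j"
  shows "y (i, j) + y (j, i) \<in> {0, 1}"
proof -
  have bin: "y (k, l) \<in> {0, 1}" if "k \<in> nodes N" "l \<in> nodes N" "k \<noteq> l" for k l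
    using assms(1) that by (auto simp: base_constraints_def ordered_pairs_def)
  have "y (i, j) \<le> (\<Sum>l\<in>nodes N - {i}. y (i, l))"
  proof (rule member_le_sum)
    show "0 \<le> y (i, l)" if "l \<in> nodes N - {i} - {j}" for l
      using bin[of i l] that assms(2) by auto
  qed (use assms(3,4) in \<open>auto simp: nodes_def\<close>)
  moreover have "(\<Sum>l\<in>nodes N - {i}. y (i, l)) + x i \<le> 1" "y (j, i) \<le> x i"
    using assms by (auto simp: base_constraints_def ordered_pairs_def)
  ultimately have "y (i, j) + y (j, i) \<le> 1"
    by linarith
  then show ?thesis
    using bin[of i j] bin[of j i] assms(2-4) by auto
qed

lemma arc_reduction_bounds:
  assumes "valid_instance N" "base_constraints N x y \<delta>" "a \<in> arcs_for N i j"
  shows "0 \<le> \<delta> (edge_of a)" "\<delta> (edge_of a) \<le> len N (edge_of a)" "0 \<le> max_red N (edge_of a)"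
proof -
  have "edge_of a \<in> edges N"
    using assms(3) by (cases a) (auto simp: arcs_for_def arc_graph_def edge_of_def)
  then show "0 \<le> \<delta> (edge_of a)" "\<delta> (edge_of a) \<le> len N (edge_of a)"
      "0 \<le> max_red N (edge_of a)"
    using assms(1,2) by (auto simp: valid_instance_def base_constraints_def intro: order.trans)
       (meson less_imp_le order.trans)+
qed

text \<open>Reductions only shorten a path that already fits into the radius, so one path serves both
  versions and every \<open>\<delta>\<close>. Scaling its flow by \<open>y\<^sub>i\<^sub>j + y\<^sub>j\<^sub>i\<close> covers the unassigned pairs too.\<close>

lemma close_pair_satisfiable:
  assumes "valid_instance N" "base_constraints N x y \<delta>"
    and "i \<in> nodes N" "j \<in> nodes N" "i \<noteq> j" "distance N i j \<le> ereal (radius N)"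
  shows "\<exists>f \<alpha>. pair_constraints_orig N y \<delta> i j f \<alpha>"
    and "\<exists>f \<gamma>. pair_constraints_alt N y \<delta> i j f \<gamma>"
proof -
  obtain p where p: "pre_digraph.apath (arc_graph N) i p j"
    and short: "(\<Sum>a\<in>set p. len N (edge_of a)) \<le> radius N"
    using short_path_exists[OF assms(1,6)] .
  define f where "f a = (y (i, j) + y (j, i)) * of_bool (a \<in> set p)" for a
  have s: "y (i, j) + y (j, i) \<in> {0, 1}"
    by (rule pair_demand_binary[OF assms(2-5)])
  then have flow: "flow_constraints N y i j f"
    unfolding f_def by (rule path_flow[OF assms(1) p assms(5)])
  have f01: "f a \<in> {0, 1}" for a
    using s by (auto simp: f_def)
  interpret fin_digraph "arc_graph N"
    by (rule fin_arc_graph[OF assms(1)])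
  have fin: "finite (arcs_for N i j)"
    by (simp add: arcs_for_def)
  note bounds = arc_reduction_bounds[OF assms(1,2), where i=i and j=j]
  have "(\<Sum>a\<in>arcs_for N i j. f a * len N (edge_of a)) =
      (\<Sum>a\<in>set p. (y (i, j) + y (j, i)) * len N (edge_of a))"
    by (rule sum.mono_neutral_cong_right)
      (use fin apath_arcs_for[OF assms(1) p] in \<open>auto simp: f_def\<close>)
  also have "\<dots> = (y (i, j) + y (j, i)) * (\<Sum>a\<in>set p. len N (edge_of a))"
    by (simp only: sum_distrib_left)
  also have "\<dots> \<le> radius N"
    using s short assms(1) by (auto simp: valid_instance_def)
  finally have len: "(\<Sum>a\<in>arcs_for N i j. f a * len N (edge_of a)) \<le> radius N" .
  \<comment> \<open>The least admissible \<open>\<alpha>\<close> for this flow: the reduced length on arcs that carry it, 0 elsewhere.\<close>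
  let ?\<alpha> = "\<lambda>a. f a * (len N (edge_of a) - \<delta> (edge_of a))"
  have \<alpha>: "?\<alpha> a \<le> f a * len N (edge_of a)" "f a * len N (edge_of a) - \<delta> (edge_of a) \<le> ?\<alpha> a"
    "0 \<le> ?\<alpha> a" "?\<alpha> a \<le> len N (edge_of a) - \<delta> (edge_of a)"
    "0 \<le> max_red N (edge_of a) * f a"
    if "a \<in> arcs_for N i j" for a
    using f01[of a] bounds[OF that] by auto
  have "(\<Sum>a\<in>arcs_for N i j. ?\<alpha> a) \<le> radius N"
    using sum_mono[OF \<alpha>(1)] len by (rule order_trans)
  then have "pair_constraints_orig N y \<delta> i j f ?\<alpha>"
    unfolding pair_constraints_orig_def by (intro conjI ballI \<alpha> flow)
  then show "\<exists>f \<alpha>. pair_constraints_orig N y \<delta> i j f \<alpha>"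
    by blast
  have "pair_constraints_alt N y \<delta> i j f (\<lambda>_. 0)"
    unfolding pair_constraints_alt_def
    by (intro conjI ballI \<alpha>(5) bounds(1) flow order_refl) (use len in simp_all)
  then show "\<exists>f \<gamma>. pair_constraints_alt N y \<delta> i j f \<gamma>"
    by blast
qed

section \<open>Pairs can be treated independently\<close>

type_synonym pair_constraints =
  "(nat \<times> nat \<Rightarrow> real) \<Rightarrow> (nat set \<Rightarrow> real) \<Rightarrow> nat \<Rightarrow> nat \<Rightarrow>
   (nat \<times> nat \<Rightarrow> real) \<Rightarrow> (nat \<times> nat \<Rightarrow> real) \<Rightarrow> bool"

text \<open>Abstracting over the pair constraints lets one gluing argument serve both versions.\<close>

definition feasible :: "instance_data \<Rightarrow> pair_constraints \<Rightarrow> (nat \<times> nat) set \<Rightarrow> solution set" where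
  "feasible N C K = {(x, y, \<delta>, f, \<alpha>).
     x \<in> extensional (nodes N) \<and> y \<in> extensional (ordered_pairs N) \<and> \<delta> \<in> extensional (edges N) \<and>
     f \<in> extensional (pair_arc_index N K) \<and> \<alpha> \<in> extensional (pair_arc_index N K) \<and>
     base_constraints N x y \<delta> \<and>
     (\<forall>(i, j)\<in>K. C y \<delta> i j (\<lambda>a. f ((i, j), a)) (\<lambda>a. \<alpha> ((i, j), a)))}"

lemma feasible_orig_eq: "feasible_orig N = feasible N (pair_constraints_orig N)"
  by (simp add: fun_eq_iff feasible_orig_def feasible_def)

lemma feasible_alt_eq: "feasible_alt N = feasible N (pair_constraints_alt N)"
  by (simp add: fun_eq_iff feasible_alt_def feasible_def)

text \<open>Solutions are extensional, so assembling them from single pairs alters the functions off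
  \<open>arcs_for\<close>; this locality makes the alteration harmless.\<close>

definition arc_local :: "instance_data \<Rightarrow> pair_constraints \<Rightarrow> bool" where
  "arc_local N C \<longleftrightarrow> (\<forall>y \<delta> i j f \<alpha> f' \<alpha>'.
     (\<forall>a\<in>arcs_for N i j. f a = f' a \<and> \<alpha> a = \<alpha>' a) \<longrightarrow> C y \<delta> i j f \<alpha> \<longrightarrow> C y \<delta> i j f' \<alpha>')"

lemma arc_localD:
  assumes "arc_local N C" "C y \<delta> i j f \<alpha>"
    and "\<And>a. a \<in> arcs_for N i j \<Longrightarrow> f a = f' a \<and> \<alpha> a = \<alpha>' a"
  shows "C y \<delta> i j f' \<alpha>'"
  using assms unfolding arc_local_def by blast

lemma flow_constraints_cong:
  assumes "\<And>a. a \<in> arcs_for N i j \<Longrightarrow> f a = f' a"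
  shows "flow_constraints N y i j f = flow_constraints N y i j f'"
proof -
  let ?G = "arc_graph N"
  have "sum f (out_arcs ?G k - in_arcs ?G i) = sum f' (out_arcs ?G k - in_arcs ?G i)"
    "sum f (in_arcs ?G k - out_arcs ?G j) = sum f' (in_arcs ?G k - out_arcs ?G j)"
    if "k \<in> nodes N - {i, j}" for k
    by (intro sum.cong refl assms; use that in \<open>auto simp: arcs_for_def\<close>)+
  moreover have "sum f (out_arcs ?G i \<inter> arcs_for N i j) = sum f' (out_arcs ?G i \<inter> arcs_for N i j)"
    "sum f (in_arcs ?G j \<inter> arcs_for N i j) = sum f' (in_arcs ?G j \<inter> arcs_for N i j)"
    by (intro sum.cong refl assms; auto)+
  ultimately show ?thesis
    using assms by (simp add: flow_constraints_def Let_def)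
qed

lemma arc_local_orig: "arc_local N (pair_constraints_orig N)"
  unfolding arc_local_def
proof (intro allI impI)
  fix y \<delta> i j f \<alpha> f' \<alpha>'
  assume eq: "\<forall>a\<in>arcs_for N i j. f a = f' a \<and> \<alpha> a = \<alpha>' a"
    and C: "pair_constraints_orig N y \<delta> i j f \<alpha>"
  have "flow_constraints N y i j f = flow_constraints N y i j f'"
    by (rule flow_constraints_cong) (use eq in blast)
  with C eq show "pair_constraints_orig N y \<delta> i j f' \<alpha>'"
    by (simp add: pair_constraints_orig_def cong: sum.cong)
qed

lemma arc_local_alt: "arc_local N (pair_constraints_alt N)"
  unfolding arc_local_def
proof (intro allI impI)
  fix y \<delta> i j f \<gamma> f' \<gamma>'
  assume eq: "\<forall>a\<in>arcs_for N i j. f a = f' a \<and> \<gamma> a = \<gamma>' a"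
    and C: "pair_constraints_alt N y \<delta> i j f \<gamma>"
  have "flow_constraints N y i j f = flow_constraints N y i j f'"
    by (rule flow_constraints_cong) (use eq in blast)
  with C eq show "pair_constraints_alt N y \<delta> i j f' \<gamma>'"
    by (simp add: pair_constraints_alt_def cong: sum.cong)
qed

text \<open>No constraint involves the variables of two pairs, so witnesses for the single pairs can be
  chosen separately and glued together.\<close>

lemma feasible_projection:
  assumes "arc_local N C"
  shows "(\<exists>f \<alpha>. (x, y, \<delta>, f, \<alpha>) \<in> feasible N C K) \<longleftrightarrow>
    x \<in> extensional (nodes N) \<and> y \<in> extensional (ordered_pairs N) \<and> \<delta> \<in> extensional (edges N) \<and>
    base_constraints N x y \<delta> \<and> (\<forall>(i, j)\<in>K. \<exists>f \<alpha>. C y \<delta> i j f \<alpha>)" (is "?L \<longleftrightarrow> ?R")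
proof
  assume ?L
  then show ?R
    by (fastforce simp: feasible_def)
next
  assume R: ?R
  then have "\<forall>ij\<in>K. \<exists>f \<alpha>. C y \<delta> (fst ij) (snd ij) f \<alpha>"
    by fastforce
  then obtain F A where FA: "\<And>ij. ij \<in> K \<Longrightarrow> C y \<delta> (fst ij) (snd ij) (F ij) (A ij)"
    by metis
  define f where "f = restrict (\<lambda>(ij, a). F ij a) (pair_arc_index N K)"
  define \<alpha> where "\<alpha> = restrict (\<lambda>(ij, a). A ij a) (pair_arc_index N K)"
  have "C y \<delta> i j (\<lambda>a. f ((i, j), a)) (\<lambda>a. \<alpha> ((i, j), a))" if "(i, j) \<in> K" for i j
    using that by (intro arc_localD[OF assms FA[OF that, unfolded fst_conv snd_conv]])
      (auto simp: f_def \<alpha>_def pair_arc_index_def)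
  then have "(x, y, \<delta>, f, \<alpha>) \<in> feasible N C K"
    using R by (auto simp: feasible_def f_def \<alpha>_def)
  then show ?L
    by blast
qed

lemma optimal_value_cong:
  assumes "\<And>x y \<delta>. (\<exists>f \<alpha>. (x, y, \<delta>, f, \<alpha>) \<in> S) \<longleftrightarrow> (\<exists>f \<alpha>. (x, y, \<delta>, f, \<alpha>) \<in> T)"
  shows "optimal_value N S = optimal_value N T"
proof -
  have proj: "(\<lambda>(x, y, \<delta>, f, \<alpha>). ereal (objective N x y)) ` U =
      {ereal (objective N x y) | x y \<delta>. \<exists>f \<alpha>. (x, y, \<delta>, f, \<alpha>) \<in> U}" for U :: "solution set"
    by (force simp: image_def)
  show ?thesis
    unfolding optimal_value_def proj assms ..
qed

lemma optimal_value_drop_pairs: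
  assumes "arc_local N C" "P \<subseteq> K"
    and "\<And>x y \<delta> i j. base_constraints N x y \<delta> \<Longrightarrow> (i, j) \<in> P \<Longrightarrow> \<exists>f \<alpha>. C y \<delta> i j f \<alpha>"
  shows "optimal_value N (feasible N C (K - P)) = optimal_value N (feasible N C K)"
  using assms(2,3)
  by (intro optimal_value_cong, unfold feasible_projection[OF assms(1)]) blast

theorem proposition1:
  fixes N :: instance_data and P :: "(nat \<times> nat) set"
  assumes "valid_instance N"
    and "P \<subseteq> {(i, j). i \<in> nodes N \<and> j \<in> nodes N \<and> i < j \<and> distance N i j \<le> ereal (radius N)}"
  shows "optimal_value N (reduced_orig N P) = optimal_value N (flow_cov_orig N)
       \<and> optimal_value N (reduced_alt N P) = optimal_value N (flow_cov_alt N)"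
proof -
  have pairs: "P \<subseteq> node_pairs N"
    using assms(2) by (auto simp: node_pairs_def)
  have close: "i \<in> nodes N" "j \<in> nodes N" "i \<noteq> j" "distance N i j \<le> ereal (radius N)"
    if "(i, j) \<in> P" for i j
    using assms(2) that by auto
  show ?thesis
    unfolding feasible_orig_eq feasible_alt_eq
    by (intro conjI optimal_value_drop_pairs[OF arc_local_orig pairs]
        optimal_value_drop_pairs[OF arc_local_alt pairs]
        close_pair_satisfiable[OF assms(1)] close)
qed

end
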